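(* For a finite semigroup $S$, the following are equivalent: (i) The cyclic graph $\Gamma(S)$ is equal to the power graph $\mathrm{Pow}(S)$. (ii) Every cyclic subgroup of $S$ has prime power order. (iii) For each $a\in S$, we have $\langle a\rangle=M(m,p^n)$ for some prime $p$, some $m\in\mathbb{N}$ and some $n\in\mathbb{N}_0$.
   Context: $\mathbb{N}$ is the set of positive integers and $\mathbb{N}_0=\mathbb{N}\cup\{0\}$. For $X\subseteq S$, $\langle X\rangle$ is the subsemigroup generated by $X$; $\langle a\rangle=\{a^k:k\in\mathbb{N}\}$. For an element $a$ of a finite semigroup, the index $m$ of $a$ is the least $x\in\mathbb{N}$ such that $a^x=a^y$ for some $y\in\mathbb{N}$, $y\neq x$, and the period $r$ of $a$ is the least $x\in\mathbb{N}$ with $a^{m+x}=a^m$; $\langle a\rangle=M(m,r)$ means that $a$ has index $m$ and period $r$. A subgroup of $S$ is a subsemigroup of $S$ that is a group under the operation of $S$ (with its own identity element); a cyclic subgroup is a subgroup that is a cyclic group. A prime power is a number of the form $p^n$ with $p$ prime and $n\in\mathbb{N}_0$ (so $1$ is allowed). Both graphs are simple graphs with vertex set $S$. In $\Gamma(S)$, distinct $x,y$ are adjacent if and only if $\langle x,y\rangle=\langle z\rangle$ for some $z\in S$. In $\mathrm{Pow}(S)$, distinct $x,y$ are adjacent if and only if $x=y^k$ or $y=x^k$ for some $k\in\mathbb{N}$. Two graphs on $S$ are equal if they have the same edges. *)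

theory Defs
  imports "HOL.Hull" "HOL-Computational_Algebra.Primes" "HOL-Algebra.Elementary_Groups"
begin

text \<open>A finite semigroup is a type of class \<open>{semigroup_mult, finite}\<close>; the universe of the type
  plays the role of the set \<open>S\<close>.\<close>

text \<open>The class \<open>semigroup_mult\<close> has no unit, so the operator \<open>^\<close> is not available. Only exponents
  \<open>k > 0\<close> are meaningful; the value at \<open>0\<close> is a dummy, and every use below requires \<open>k > 0\<close>.\<close>

definition spow :: "'a::semigroup_mult \<Rightarrow> nat \<Rightarrow> 'a" where
  "spow a k = (((*) a) ^^ (k - 1)) a"

definition subsemigroup :: "'a::semigroup_mult set \<Rightarrow> bool" where
  "subsemigroup H \<longleftrightarrow> (\<forall>x\<in>H. \<forall>y\<in>H. x * y \<in> H)"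

definition sgen :: "'a::semigroup_mult set \<Rightarrow> 'a set" where
  "sgen X = subsemigroup hull X"

definition sindex :: "'a::semigroup_mult \<Rightarrow> nat" where
  "sindex a = (LEAST x. x > 0 \<and> (\<exists>y>0. y \<noteq> x \<and> spow a x = spow a y))"

definition speriod :: "'a::semigroup_mult \<Rightarrow> nat" where
  "speriod a = (LEAST x. x > 0 \<and> spow a (sindex a + x) = spow a (sindex a))"

text \<open>\<open>gen_is_M a m r\<close> renders the notation \<open>\<langle>a\<rangle> = M(m,r)\<close>.\<close>

definition gen_is_M :: "'a::semigroup_mult \<Rightarrow> nat \<Rightarrow> nat \<Rightarrow> bool" where
  "gen_is_M a m r \<longleftrightarrow> sindex a = m \<and> speriod a = r"

text \<open>The identity \<open>e\<close> of the subgroup is its own; the ambient semigroup need not have one.\<close>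

definition cyclic_subgroup :: "'a::semigroup_mult set \<Rightarrow> bool" where
  "cyclic_subgroup H \<longleftrightarrow> subsemigroup H \<and>
     (\<exists>e. group \<lparr>carrier = H, mult = (*), one = e\<rparr> \<and>
          cyclic_group \<lparr>carrier = H, mult = (*), one = e\<rparr>)"

text \<open>Unlike \<open>primepow\<close> in \<open>HOL-Number_Theory\<close>, this admits \<open>1 = p ^ 0\<close>.\<close>

definition prime_power :: "nat \<Rightarrow> bool" where
  "prime_power q \<longleftrightarrow> (\<exists>p n. prime p \<and> q = p ^ n)"

text \<open>A simple graph is a pair of a vertex set and a set of two-element edges.\<close>

type_synonym 'a sgraph = "'a set \<times> 'a set set"

definition cyclic_graph :: "'a::semigroup_mult sgraph" where
  "cyclic_graph = (UNIV, {{x, y} |x y. x \<noteq> y \<and> (\<exists>z. sgen {x, y} = sgen {z})})"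

definition power_graph :: "'a::semigroup_mult sgraph" where
  "power_graph = (UNIV, {{x, y} |x y. x \<noteq> y \<and> (\<exists>k>0. x = spow y k \<or> y = spow x k)})"

lemma spow_1 [simp]: "spow a (Suc 0) = a"
  by (simp add: spow_def)

lemma spow_Suc: "k > 0 \<Longrightarrow> spow a (Suc k) = a * spow a k"
  by (cases k) (simp_all add: spow_def)

lemma spow_add: "j > 0 \<Longrightarrow> k > 0 \<Longrightarrow> spow a (j + k) = spow a j * spow a k"
proof (induction j)
  case (Suc j)
  then show ?case
    by (cases "j = 0") (simp_all add: spow_Suc mult.assoc)
qed simp

lemma subsemigroup_sgen: "subsemigroup (sgen X)"
  unfolding sgen_def by (rule hull_in) (auto simp: subsemigroup_def)

lemma sgen_singleton: "sgen {a} = {spow a k |k. k > 0}"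
  unfolding sgen_def
proof (rule hull_unique)
  show "{a} \<subseteq> {spow a k |k. k > 0}"
    using spow_1[of a] by (auto intro!: exI[of _ "Suc 0"])
  show "subsemigroup {spow a k |k. k > 0}"
    unfolding subsemigroup_def
    by (auto simp: spow_add[symmetric] intro: add_pos_pos)
next
  fix T assume T: "{a} \<subseteq> T" "subsemigroup T"
  have "spow a k \<in> T" if "k > 0" for k
    using that
  proof (induction k)
    case (Suc k)
    then show ?case
      using T by (cases "k = 0") (auto simp: spow_Suc subsemigroup_def)
  qed simp
  then show "{spow a k |k. k > 0} \<subseteq> T" by auto
qed

end

theory Submission
  imports Defs "HOL-Algebra.Multiplicative_Group" "HOL-Number_Theory.Cong"
begin

text \<open>
  All three conditions say that the period of every element is a prime power.

  The powers of an element \<open>a\<close> of index \<open>m\<close> and period \<open>r\<close> satisfy \<open>a\<^sup>i = a\<^sup>j\<close>, for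
  \<open>i \<noteq> j\<close>, exactly when \<open>i, j \<ge> m\<close> and \<open>i \<equiv> j\<close> modulo \<open>r\<close> (\<open>spow_eqI\<close>, \<open>spow_eqD\<close>). Hence the
  powers with exponent at least \<open>m\<close>, called the kernel of \<open>\<langle>a\<rangle>\<close>, form a cyclic group of order \<open>r\<close>.
  Conversely, a finite cyclic subgroup is the kernel of any of its generators. So the orders of the
  cyclic subgroups are exactly the periods of the elements, which relates conditions (ii) and (iii).

  For the graphs, a power of \<open>y\<close> always generates together with \<open>y\<close> the monogenic semigroup \<open>\<langle>y\<rangle>\<close>;
  the graphs are therefore equal precisely when \<open>\<langle>x, y\<rangle> = \<langle>z\<rangle>\<close> forces one of \<open>x, y\<close> to be a power of
  the other.

  Suppose that the period of \<open>z\<close> is a prime power, and let \<open>\<langle>x, y\<rangle> = \<langle>z\<rangle>\<close>. If \<open>z\<close> has index 1, then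
  \<open>\<langle>z\<rangle>\<close> is a cyclic group of prime power order, whose subgroups form a chain, so \<open>\<langle>x\<rangle>\<close> and \<open>\<langle>y\<rangle>\<close> are
  comparable. If \<open>z\<close> has index greater than 1, then \<open>z\<close> is not a product of elements of \<open>\<langle>z\<rangle>\<close>, so
  \<open>z\<close> is \<open>x\<close> or \<open>y\<close>.

  If instead the period of some element is \<open>u v\<close> with \<open>u, v > 1\<close> coprime, and \<open>b\<close> generates the
  corresponding kernel, then \<open>b\<^sup>u\<close> and \<open>b\<^sup>v\<close> together generate \<open>\<langle>b\<rangle>\<close> although neither is a power of
  the other, so the graphs differ.
\<close>


section \<open>Powers in a finite semigroup\<close>

lemma spow_mult: "i > 0 \<Longrightarrow> j > 0 \<Longrightarrow> spow (spow a i) j = spow a (i * j)"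
proof (induction j)
  case (Suc j)
  then show ?case
    by (cases "j = 0") (simp_all add: spow_Suc spow_add)
qed simp

lemma spow_eq_shift:
  assumes "i > 0" "j > 0" "spow a i = spow a j"
  shows "spow a (i + c) = spow a (j + c)"
  using assms by (cases "c = 0") (simp_all add: spow_add)

lemma spow_in_subsemigroup:
  assumes "subsemigroup T" "a \<in> T" "k > 0"
  shows "spow a k \<in> T"
  using assms(3)
proof (induction k)
  case (Suc k)
  then show ?case
    using assms by (cases "k = 0") (auto simp: spow_Suc subsemigroup_def)
qed simp

lemma sindex_exists:
  fixes a :: "'a::{semigroup_mult, finite}"
  shows "\<exists>x>0. \<exists>y>0. y \<noteq> x \<and> spow a x = spow a y"
proof -
  have "\<not> inj_on (spow a) {0<..}"
    using finite_imageD[of "spow a" "{0<..}"] by (auto simp: infinite_Ioi)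
  then show ?thesis by (auto simp: inj_on_def)
qed

lemma sindex_witness:
  fixes a :: "'a::{semigroup_mult, finite}"
  shows "sindex a > 0 \<and> (\<exists>y>0. y \<noteq> sindex a \<and> spow a (sindex a) = spow a y)"
  unfolding sindex_def by (rule LeastI_ex) (use sindex_exists in blast)

lemma sindex_pos: "sindex (a :: 'a::{semigroup_mult, finite}) > 0"
  using sindex_witness by blast

lemma sindex_le: "x > 0 \<Longrightarrow> y > 0 \<Longrightarrow> y \<noteq> x \<Longrightarrow> spow a x = spow a y \<Longrightarrow> sindex a \<le> x"
  unfolding sindex_def by (rule Least_le) blast

lemma speriod_witness:
  fixes a :: "'a::{semigroup_mult, finite}"
  shows "speriod a > 0 \<and> spow a (sindex a + speriod a) = spow a (sindex a)"
  unfolding speriod_def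
proof (rule LeastI_ex)
  obtain y where y: "y > 0" "y \<noteq> sindex a" "spow a (sindex a) = spow a y"
    using sindex_witness by blast
  then have "sindex a \<le> y"
    using sindex_le[of y "sindex a" a] sindex_pos[of a] by simp
  with y show "\<exists>x>0. spow a (sindex a + x) = spow a (sindex a)"
    by (intro exI[of _ "y - sindex a"]) simp
qed

lemma speriod_pos: "speriod (a :: 'a::{semigroup_mult, finite}) > 0"
  using speriod_witness by blast

lemma spow_add_period:
  fixes a :: "'a::{semigroup_mult, finite}"
  assumes "sindex a \<le> k"
  shows "spow a (k + q * speriod a) = spow a k"
proof -
  have step: "spow a (l + speriod a) = spow a l" if l: "sindex a \<le> l" for l
    using spow_eq_shift[of "sindex a + speriod a" "sindex a" a "l - sindex a"]
      speriod_witness[of a] sindex_pos[of a] l by (simp add: add.commute)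
  show ?thesis
  proof (induction q)
    case (Suc q)
    then show ?case
      using step[of "k + q * speriod a"] assms by (simp add: algebra_simps)
  qed simp
qed

lemma spow_eqI:
  fixes a :: "'a::{semigroup_mult, finite}"
  assumes "sindex a \<le> i" "sindex a \<le> j" "[i = j] (mod speriod a)"
  shows "spow a i = spow a j"
  using assms
proof (induction i j rule: linorder_wlog)
  case (le i j)
  then have "speriod a dvd j - i"
    using cong_altdef_nat cong_sym by blast
  then obtain q where "j - i = speriod a * q" by blast
  with le have "j = i + q * speriod a" by (simp add: algebra_simps)
  then show ?case using spow_add_period[of a i q] le by simp
qed (simp add: cong_sym)

text \<open>Multiplying both sides by a power of \<open>a\<close> moves the smaller exponent to a number congruent to
  the index. This gives a return to the power at the index after \<open>\<bar>i - j\<bar>\<close> steps; reducing that number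
  modulo the period keeps the return, so minimality of the period makes the remainder 0.\<close>

lemma spow_eqD:
  fixes a :: "'a::{semigroup_mult, finite}"
  assumes "i > 0" "j > 0" "spow a i = spow a j" "i \<noteq> j"
  shows "sindex a \<le> i \<and> sindex a \<le> j \<and> [i = j] (mod speriod a)"
  using assms
proof (induction i j rule: linorder_wlog)
  case (le i j)
  let ?m = "sindex a" and ?r = "speriod a"
  define d where "d = j - i"
  have m: "?m \<le> i" "?m \<le> j"
    using le sindex_le[of i j a] sindex_le[of j i a] by auto
  (* i + c is the index plus a multiple of the period; the factor i keeps the subtraction from truncating. *)
  define c where "c = ?m + ?r * i - i"
  have "i * 1 \<le> i * ?r" using speriod_pos[of a] by (intro mult_le_mono2) simp
  then have ic: "i + c = ?m + i * ?r"
    unfolding c_def mult_1_right mult.commute[of ?r] by linarith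
  moreover have "j = i + d" using le by (simp add: d_def)
  ultimately have jc: "j + c = ?m + d + i * ?r" by simp
  have "spow a ?m = spow a (i + c)"
    unfolding ic using spow_add_period[of a ?m i] by simp
  also have "\<dots> = spow a (j + c)"
    using le by (intro spow_eq_shift)
  also have "\<dots> = spow a (?m + d)"
    unfolding jc by (rule spow_add_period) simp
  also have "\<dots> = spow a (?m + d mod ?r)"
    by (rule spow_eqI) (simp_all add: cong_def mod_simps)
  finally have ret: "spow a (?m + d mod ?r) = spow a ?m" by simp
  have "d mod ?r = 0"
  proof (rule ccontr)
    assume "d mod ?r \<noteq> 0"
    with ret have "?r \<le> d mod ?r"
      unfolding speriod_def[of a] by (intro Least_le) simp
    then show False using mod_less_divisor[OF speriod_pos[of a], of d] by simp
  qed
  then have "[j = i] (mod ?r)"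
    using le by (simp add: cong_altdef_nat d_def dvd_eq_mod_eq_0)
  then show ?case using m by (simp add: cong_sym)
next
  case (sym i j)
  then show ?case by (metis cong_sym)
qed


section \<open>Cyclic subgroups and periods\<close>

definition power_kernel :: "'a::semigroup_mult \<Rightarrow> 'a set" where
  "power_kernel a = spow a ` {sindex a..}"

lemma card_power_kernel:
  fixes a :: "'a::{semigroup_mult, finite}"
  shows "card (power_kernel a) = speriod a"
proof -
  let ?m = "sindex a" and ?r = "speriod a"
  have "power_kernel a = spow a ` {?m..<?m + ?r}"
  proof
    show "power_kernel a \<subseteq> spow a ` {?m..<?m + ?r}"
    proof
      fix x assume "x \<in> power_kernel a"
      then obtain k where k: "k \<ge> ?m" "x = spow a k" by (auto simp: power_kernel_def)
      have "spow a k = spow a (?m + (k - ?m) mod ?r)"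
        by (rule spow_eqI) (use k in \<open>simp_all add: cong_def mod_simps\<close>)
      then show "x \<in> spow a ` {?m..<?m + ?r}"
        using k speriod_pos[of a] by auto
    qed
  qed (auto simp: power_kernel_def)
  moreover have "inj_on (spow a) {?m..<?m + ?r}"
  proof (rule inj_onI, rule ccontr)
    fix i j assume ij: "i \<in> {?m..<?m + ?r}" "j \<in> {?m..<?m + ?r}" "spow a i = spow a j" "i \<noteq> j"
    then have "[?m + (i - ?m) = ?m + (j - ?m)] (mod ?r)"
      using spow_eqD[of i j a] sindex_pos[of a] by simp
    then have "[i - ?m = j - ?m] (mod ?r)"
      by (simp only: cong_add_lcancel_nat)
    then have "i - ?m = j - ?m"
      using ij by (intro cong_less_imp_eq_nat) auto
    then show False using ij by auto
  qed
  ultimately show ?thesis by (simp add: card_image)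
qed

text \<open>Sending an exponent to its residue modulo the period \<open>r\<close> identifies the kernel with the additive
  group of the integers modulo \<open>r\<close>. With \<open>m\<close> the index, \<open>m r\<close> and \<open>m r + 1\<close> are exponents of at least
  \<open>m\<close> with residues 0 and 1, so they give the identity and a generator.\<close>

lemma cyclic_subgroup_power_kernel:
  fixes a :: "'a::{semigroup_mult, finite}"
  shows "cyclic_subgroup (power_kernel a)"
proof -
  let ?m = "sindex a" and ?r = "speriod a"
  define e where "e = spow a (?m * ?r)"
  let ?G = "\<lparr>carrier = power_kernel a, mult = (*), one = e\<rparr>"
  have pos: "?m > 0" "?r > 0" using sindex_pos speriod_pos by auto
  have mr: "?m \<le> ?m * ?r" using pos by simp
  have sub: "subsemigroup (power_kernel a)"
    unfolding subsemigroup_def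
  proof (intro ballI)
    fix x y assume "x \<in> power_kernel a" "y \<in> power_kernel a"
    then obtain i j where ij: "i \<ge> ?m" "x = spow a i" "j \<ge> ?m" "y = spow a j"
      by (auto simp: power_kernel_def)
    then have "x * y = spow a (i + j)" using pos by (simp add: spow_add)
    then show "x * y \<in> power_kernel a" using ij by (auto simp: power_kernel_def)
  qed
  have e: "e \<in> power_kernel a" using mr by (auto simp: e_def power_kernel_def)
  have grp: "group ?G"
  proof (rule groupI)
    fix x assume "x \<in> carrier ?G"
    then obtain k where k: "k \<ge> ?m" "x = spow a k" by (auto simp: power_kernel_def)
    have "e * x = spow a (?m * ?r + k)"
      using k pos by (simp add: e_def spow_add)
    also have "\<dots> = x"
      unfolding k(2) by (rule spow_eqI) (use k in \<open>simp_all add: cong_def\<close>)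
    finally show "\<one>\<^bsub>?G\<^esub> \<otimes>\<^bsub>?G\<^esub> x = x" by simp
    (* The inverse needs an exponent congruent to - k; the second summand makes it reach the index. *)
    define j where "j = k * (?r - 1) + ?m * ?r"
    have jk: "j + k = (k + ?m) * ?r"
      using pos by (cases ?r) (simp_all add: j_def algebra_simps)
    have j: "j \<ge> ?m" using mr unfolding j_def by (rule trans_le_add2)
    have "spow a j * x = spow a (j + k)"
      using k j pos by (simp add: spow_add)
    also have "\<dots> = e"
      unfolding e_def by (rule spow_eqI) (use k j mr jk in \<open>simp_all add: cong_def\<close>)
    finally show "\<exists>y\<in>carrier ?G. y \<otimes>\<^bsub>?G\<^esub> x = \<one>\<^bsub>?G\<^esub>"
      using j by (auto simp: power_kernel_def)
  qed (use sub e in \<open>auto simp: subsemigroup_def mult.assoc\<close>)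
  then interpret group ?G .
  define b where "b = spow a (?m * ?r + 1)"
  have b: "b \<in> power_kernel a"
    unfolding b_def power_kernel_def using mr by (intro imageI) (simp only: atLeast_iff trans_le_add1)
  have pow_b: "b [^]\<^bsub>?G\<^esub> k = spow a (?m * ?r + k)" for k :: nat
  proof (induction k)
    case (Suc k)
    have "b [^]\<^bsub>?G\<^esub> Suc k = spow a (?m * ?r + k + (?m * ?r + 1))"
      using Suc pos spow_add[of "?m * ?r + k" "?m * ?r + 1" a] by (simp add: b_def)
    also have "\<dots> = spow a (?m * ?r + Suc k)"
    proof (rule spow_eqI)
      show "?m \<le> ?m * ?r + k + (?m * ?r + 1)" "?m \<le> ?m * ?r + Suc k"
        using mr by linarith+
      show "[?m * ?r + k + (?m * ?r + 1) = ?m * ?r + Suc k] (mod ?r)"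
        by (simp add: cong_def mod_simps)
    qed
    finally show ?case .
  qed (simp add: e_def)
  have "power_kernel a \<subseteq> range (\<lambda>n::int. b [^]\<^bsub>?G\<^esub> n)"
  proof
    fix x assume "x \<in> power_kernel a"
    then obtain k where k: "k \<ge> ?m" "x = spow a k" by (auto simp: power_kernel_def)
    have "x = spow a (?m * ?r + k)"
      unfolding k(2) by (rule spow_eqI) (use k in \<open>simp_all add: cong_def\<close>)
    then have "x = b [^]\<^bsub>?G\<^esub> int k" by (simp only: pow_b int_pow_int)
    then show "x \<in> range (\<lambda>n::int. b [^]\<^bsub>?G\<^esub> n)" by blast
  qed
  moreover have "range (\<lambda>n::int. b [^]\<^bsub>?G\<^esub> n) \<subseteq> power_kernel a"
    using int_pow_closed[of b] b by auto
  ultimately have "cyclic_group ?G"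
    unfolding cyclic_group using b by auto
  then show ?thesis unfolding cyclic_subgroup_def using sub grp by blast
qed

text \<open>In a finite group the identity is a positive power of a generator \<open>g\<close>. So \<open>g\<close> recurs among
  its own powers, which means that its index is 1 and its kernel is all of \<open>\<langle>g\<rangle>\<close>.\<close>

lemma cyclic_subgroup_is_power_kernel:
  fixes H :: "'a::{semigroup_mult, finite} set"
  assumes "cyclic_subgroup H"
  shows "\<exists>g. H = power_kernel g"
proof -
  from assms obtain e where sub: "subsemigroup H"
    and grp: "group \<lparr>carrier = H, mult = (*), one = e\<rparr>"
    and cyc: "cyclic_group \<lparr>carrier = H, mult = (*), one = e\<rparr>"
    by (auto simp: cyclic_subgroup_def)
  let ?G = "\<lparr>carrier = H, mult = (*), one = e\<rparr>"
  interpret group ?G by (rule grp)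
  obtain g where g: "g \<in> H" and gen: "subgroup_generated ?G {g} = ?G"
    using cyc by (auto simp: cyclic_group_def)
  have pow_g: "g [^]\<^bsub>?G\<^esub> Suc k = spow g (Suc k)" for k
  proof (induction k)
    case (Suc k)
    then show ?case using spow_add[of "Suc k" 1 g] by simp
  qed (use l_one[of g] g in simp)
  have o: "ord g > 0" using ord_ge_1[of g] g by (simp add: Suc_le_eq)
  have one: "e = spow g (ord g)"
    using pow_ord_eq_1[of g] g o pow_g[of "ord g - 1"] by simp
  have "spow g (Suc (ord g)) = spow g 1"
    using o r_one[of g] g by (simp add: spow_Suc one[symmetric])
  then have m: "sindex g = 1"
    using sindex_le[of 1 "Suc (ord g)" g] o sindex_pos[of g] by simp
  have "H = generate ?G {g}"
    using carrier_subgroup_generated_by_singleton[of g] gen g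
    by (metis carrier_subgroup_generated partial_object.select_convs(1) Int_insert_right_if1 Int_empty_right)
  also have "\<dots> = {g [^]\<^bsub>?G\<^esub> k |k. k \<in> (UNIV :: nat set)}"
    using generate_pow_nat[of g] g o by simp
  also have "\<dots> \<subseteq> power_kernel g"
  proof safe
    fix k :: nat
    show "g [^]\<^bsub>?G\<^esub> k \<in> power_kernel g"
    proof (cases k)
      case 0
      then show ?thesis using one o m by (auto simp: power_kernel_def)
    next
      case (Suc l)
      then show ?thesis using m unfolding power_kernel_def Suc pow_g by (intro imageI) simp
    qed
  qed
  finally have "H \<subseteq> power_kernel g" .
  moreover have "power_kernel g \<subseteq> H"
    using spow_in_subsemigroup[OF sub g] m by (auto simp: power_kernel_def)
  ultimately show ?thesis by blast
qed

lemma cyclic_subgroups_iff_periods: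
  "(\<forall>H :: 'a::{semigroup_mult, finite} set. cyclic_subgroup H \<longrightarrow> prime_power (card H))
     \<longleftrightarrow> (\<forall>a :: 'a. prime_power (speriod a))"
  by (metis card_power_kernel cyclic_subgroup_power_kernel cyclic_subgroup_is_power_kernel)


section \<open>Prime powers and congruences\<close>

lemma not_prime_power_coprime_factors:
  assumes "r > 0" "\<not> prime_power r"
  obtains u v where "r = u * v" "coprime u v" "u > 1" "v > 1"
proof -
  have "r \<noteq> 1"
    using assms(2) two_is_prime_nat power_0 unfolding prime_power_def by metis
  then obtain p where p: "prime p" "p dvd r" using prime_factor_nat by blast
  obtain v where v: "r = p ^ multiplicity p r * v" "\<not> p dvd v"
    using multiplicity_decompose'[of r p] assms p by (metis not_prime_unit not_gr_zero)
  have mult: "multiplicity p r > 0"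
    using p assms by (simp add: prime_multiplicity_gt_zero_iff)
  show ?thesis
  proof
    show "r = p ^ multiplicity p r * v" by (rule v)
    show "coprime (p ^ multiplicity p r) v"
      using p v by (simp add: prime_imp_coprime)
    show "p ^ multiplicity p r > 1"
      using p mult prime_gt_1_nat by (metis one_less_power)
    have "v \<noteq> 0" using v assms(1) by (metis mult_0_right less_not_refl)
    moreover have "v \<noteq> 1" using v(1) assms(2) p by (metis mult_1_right prime_power_def)
    ultimately show "v > 1" by simp
  qed
qed

lemma coprime_combination_cong_1:
  fixes u v :: nat
  assumes "coprime u v" "u > 1" "v > 1"
  obtains i j where "i > 0" "j > 0" "[u * i + v * j = 1] (mod u * v)"
proof -
  obtain i where i: "[u * i = 1] (mod v)"
    using cong_solve_coprime_nat[OF assms(1)] by auto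
  obtain j where j: "[v * j = 1] (mod u)"
    using cong_solve_coprime_nat[of v u] assms(1) by (auto simp: coprime_commute)
  have "i > 0" using i assms(3) by (cases "i = 0") (auto simp: cong_def)
  moreover have "j > 0" using j assms(2) by (cases "j = 0") (auto simp: cong_def)
  moreover have "[u * i + v * j = 1] (mod u)" "[u * i + v * j = 1] (mod v)"
    using i j by (simp_all add: cong_def)
  then have "[u * i + v * j = 1] (mod u * v)"
    using assms(1) by (intro coprime_cong_mult_nat)
  ultimately show ?thesis by (rule that)
qed

text \<open>The subgroup of the residues modulo \<open>r\<close> generated by \<open>s\<close> depends only on \<open>gcd s r\<close>, and the
  divisors of a prime power form a chain under divisibility.\<close>

lemma prime_power_residues_chain:
  assumes "prime_power r"
  shows "(\<exists>k>0. [s * k = t] (mod r)) \<or> (\<exists>k>0. [t * k = s] (mod r))"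
proof -
  obtain p n where p: "prime p" and r: "r = p ^ n"
    using assms by (auto simp: prime_power_def)
  have solve: "\<exists>k>0. [x * k = y] (mod r)" if dvd: "gcd x r dvd y" for x y :: nat
  proof -
    obtain k where "[x * k = y] (mod r)" using cong_solve_dvd_nat[OF dvd] by blast
    (* Adding r turns a possible solution 0 into a positive one. *)
    then have "[x * (k + r) = y] (mod r)" by (simp add: cong_def distrib_left)
    moreover have "k + r > 0" using p r prime_gt_0_nat by simp
    ultimately show ?thesis by blast
  qed
  obtain i where i: "gcd s r = p ^ i"
    using divides_primepow_nat[OF p, of "gcd s r" n] r by auto
  obtain j where j: "gcd t r = p ^ j"
    using divides_primepow_nat[OF p, of "gcd t r" n] r by auto
  show ?thesis
  proof (cases "i \<le> j")
    case True
    then have "gcd s r dvd gcd t r" by (simp add: i j le_imp_power_dvd)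
    then show ?thesis using solve[of s t] by auto
  next
    case False
    then have "gcd t r dvd gcd s r" by (simp add: i j le_imp_power_dvd)
    then show ?thesis using solve[of t s] by auto
  qed
qed


section \<open>The two graphs\<close>

lemma sgen_superset: "X \<subseteq> sgen X"
  unfolding sgen_def by (rule hull_subset)

lemma sgen_least: "X \<subseteq> T \<Longrightarrow> subsemigroup T \<Longrightarrow> sgen X \<subseteq> T"
  unfolding sgen_def by (rule hull_minimal)

lemma sgen_pair_power:
  assumes "k > 0"
  shows "sgen {y, spow y k} = sgen {y}"
proof
  show "sgen {y, spow y k} \<subseteq> sgen {y}"
    using assms sgen_superset[of "{y}"]
    by (intro sgen_least) (auto simp: subsemigroup_sgen intro: spow_in_subsemigroup)
  show "sgen {y} \<subseteq> sgen {y, spow y k}"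
    using sgen_superset[of "{y, spow y k}"] by (intro sgen_least) (auto simp: subsemigroup_sgen)
qed

text \<open>Every edge of the power graph is an edge of the cyclic graph, so equality amounts to the other
  inclusion. The case \<open>x = y\<close> may be included because \<open>x\<close> is its own first power.\<close>

lemma graphs_eq_iff:
  "(cyclic_graph :: 'a::semigroup_mult sgraph) = power_graph \<longleftrightarrow>
     (\<forall>x y z :: 'a. sgen {x, y} = sgen {z} \<longrightarrow> (\<exists>k>0. x = spow y k \<or> y = spow x k))"
  (is "?L \<longleftrightarrow> ?R")
proof
  assume eq: ?L
  show ?R
  proof (intro allI impI)
    fix x y z :: 'a assume z: "sgen {x, y} = sgen {z}"
    show "\<exists>k>0. x = spow y k \<or> y = spow x k"
    proof (cases "x = y")
      case True
      then show ?thesis by (intro exI[of _ 1]) simp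
    next
      case False
      then have "{x, y} \<in> snd (cyclic_graph :: 'a sgraph)"
        using z by (auto simp: cyclic_graph_def)
      then have "{x, y} \<in> snd (power_graph :: 'a sgraph)" by (simp add: eq)
      then show ?thesis by (auto simp: power_graph_def doubleton_eq_iff)
    qed
  qed
next
  assume R: ?R
  have gen: "\<exists>z. sgen {x, y} = sgen {z}" if "k > 0" "x = spow y k \<or> y = spow x k" for x y :: 'a and k
    using that sgen_pair_power[of k y] sgen_pair_power[of k x] by (auto simp: insert_commute)
  have "(\<exists>z. sgen {x, y} = sgen {z}) \<longleftrightarrow> (\<exists>k>0. x = spow y k \<or> y = spow x k)" for x y :: 'a
    using R gen by blast
  then show ?L by (simp only: cyclic_graph_def power_graph_def)
qed

text \<open>If the period is \<open>u v\<close> with \<open>u, v > 1\<close> coprime and \<open>b\<close> generates the kernel, then, by Bezout,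
  \<open>b\<close> is a product of powers of \<open>b\<^sup>u\<close> and \<open>b\<^sup>v\<close>, so these two generate \<open>\<langle>b\<rangle>\<close>. If one of them were
  a power of the other, then one of \<open>u, v\<close> would divide the other.\<close>

lemma prime_power_period_if_comparable:
  fixes a :: "'a::{semigroup_mult, finite}"
  assumes gen: "\<And>x y z :: 'a. sgen {x, y} = sgen {z} \<Longrightarrow> \<exists>k>0. x = spow y k \<or> y = spow x k"
  shows "prime_power (speriod a)"
proof (rule ccontr)
  let ?m = "sindex a" and ?r = "speriod a"
  assume "\<not> prime_power ?r"
  then obtain u v where r: "?r = u * v" and uv: "coprime u v" "u > 1" "v > 1"
    using not_prime_power_coprime_factors speriod_pos by metis
  obtain i j where ij: "i > 0" "j > 0" "[u * i + v * j = 1] (mod ?r)"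
    using coprime_combination_cong_1[OF uv] r by metis
  define b where "b = spow a (?m * ?r + 1)"
  have pow_b: "spow b k = spow a ((?m * ?r + 1) * k)" if "k > 0" for k
    using that by (simp only: b_def spow_mult add_gr_0 zero_less_one simp_thms)
  have le: "?m \<le> (?m * ?r + 1) * k" if "k > 0" for k
  proof -
    have "?m * 1 \<le> ?m * (?r * k)" using that speriod_pos[of a] by (intro mult_le_mono2) simp
    then have "?m \<le> ?m * ?r * k" by (simp only: mult_1_right mult.assoc)
    then show ?thesis unfolding distrib_right by (rule trans_le_add1)
  qed
  have cong: "[(?m * ?r + 1) * k = k] (mod ?r)" for k
  proof -
    have "(?m * ?r + 1) * k = k + (?m * k) * ?r" by (simp add: algebra_simps)
    then show ?thesis by (simp only: cong_def mod_mult_self1)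
  qed
  have eq_iff: "spow b k = spow b l \<longleftrightarrow> [k = l] (mod ?r)" if "k > 0" "l > 0" for k l
  proof
    assume "spow b k = spow b l"
    then have "spow a ((?m * ?r + 1) * k) = spow a ((?m * ?r + 1) * l)"
      using that by (simp only: pow_b)
    moreover have "(?m * ?r + 1) * k > 0" "(?m * ?r + 1) * l > 0"
      using that by simp_all
    ultimately have "[(?m * ?r + 1) * k = (?m * ?r + 1) * l] (mod ?r)"
      using spow_eqD[of "(?m * ?r + 1) * k" "(?m * ?r + 1) * l" a]
      by (cases "(?m * ?r + 1) * k = (?m * ?r + 1) * l") (simp_all only: cong_refl simp_thms)
    then show "[k = l] (mod ?r)"
      using cong_trans[OF cong_sym[OF cong[of k]] cong_trans[OF _ cong[of l]]] by blast
  next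
    assume "[k = l] (mod ?r)"
    then have "[(?m * ?r + 1) * k = (?m * ?r + 1) * l] (mod ?r)" by (rule cong_scalar_left)
    then show "spow b k = spow b l"
      unfolding pow_b[OF that(1)] pow_b[OF that(2)] by (intro spow_eqI le that)
  qed
  have "spow b (u * i + v * j) = spow b 1"
    using ij uv by (subst eq_iff) auto
  then have b: "b = spow (spow b u) i * spow (spow b v) j"
    using ij uv by (simp add: spow_add spow_mult)
  have "sgen {spow b u, spow b v} = sgen {b}"
  proof
    show "sgen {spow b u, spow b v} \<subseteq> sgen {b}"
      using uv sgen_superset[of "{b}"]
      by (intro sgen_least) (auto simp: subsemigroup_sgen intro!: spow_in_subsemigroup)
    let ?X = "{spow b u, spow b v}"
    have "spow (spow b u) i \<in> sgen ?X" "spow (spow b v) j \<in> sgen ?X"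
      using sgen_superset[of ?X] ij by (auto simp: subsemigroup_sgen intro!: spow_in_subsemigroup)
    then have "b \<in> sgen ?X"
      using subsemigroup_sgen[of ?X] by (subst b) (auto simp: subsemigroup_def)
    then show "sgen {b} \<subseteq> sgen ?X"
      by (intro sgen_least) (auto simp: subsemigroup_sgen)
  qed
  then obtain k where k: "k > 0" "spow b u = spow b (v * k) \<or> spow b v = spow b (u * k)"
    using gen[of "spow b u" "spow b v" b] uv by (auto simp: spow_mult)
  then have "[u = v * k] (mod u * v) \<or> [v = u * k] (mod u * v)"
    using uv by (simp add: eq_iff r)
  then have "v dvd u \<or> u dvd v"
    by (metis cong_dvd_iff cong_dvd_modulus_nat dvd_triv_left dvd_triv_right)
  then show False using uv by (auto dest: coprime_common_divisor_nat simp: coprime_absorb_left coprime_absorb_right)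
qed

text \<open>The powers \<open>z\<^sup>k\<close> with \<open>k > 1\<close> form a subsemigroup, which omits \<open>z\<close> because \<open>z\<close>, having
  index greater than 1, differs from all its higher powers. A generating set must therefore leave this subsemigroup.\<close>

lemma generator_mem_of_sindex_gt_1:
  fixes z :: "'a::{semigroup_mult, finite}"
  assumes "sgen X = sgen {z}" "sindex z > 1"
  shows "z \<in> X"
proof (rule ccontr)
  assume "z \<notin> X"
  let ?T = "{spow z k |k. k > 1}"
  have "X \<subseteq> ?T"
  proof
    fix x assume x: "x \<in> X"
    then have "x \<in> sgen {z}" using assms(1) sgen_superset by blast
    then obtain k where k: "k > 0" "x = spow z k" by (auto simp: sgen_singleton)
    moreover have "k \<noteq> 1" using k x \<open>z \<notin> X\<close> by auto
    ultimately show "x \<in> ?T" by auto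
  qed
  moreover have "subsemigroup ?T"
    unfolding subsemigroup_def
  proof (intro ballI)
    fix x y assume "x \<in> ?T" "y \<in> ?T"
    then obtain i j where "i > 1" "x = spow z i" "j > 1" "y = spow z j" by auto
    then show "x * y \<in> ?T" by (auto simp: spow_add[symmetric] intro!: exI[of _ "i + j"])
  qed
  ultimately have "sgen X \<subseteq> ?T" by (rule sgen_least)
  then have "z \<in> ?T" using assms(1) sgen_superset[of "{z}"] by auto
  then obtain k where "k > 1" "spow z 1 = spow z k" by auto
  then have "sindex z \<le> 1" by (intro sindex_le[of 1 k]) auto
  then show False using assms(2) by simp
qed

lemma comparable_if_prime_power_period:
  fixes x y z :: "'a::{semigroup_mult, finite}"
  assumes r: "prime_power (speriod z)" and z: "sgen {x, y} = sgen {z}"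
  shows "\<exists>k>0. x = spow y k \<or> y = spow x k"
proof -
  have "x \<in> sgen {z}" "y \<in> sgen {z}" using z sgen_superset[of "{x, y}"] by auto
  then obtain s t where s: "s > 0" "x = spow z s" and t: "t > 0" "y = spow z t"
    by (auto simp: sgen_singleton)
  show ?thesis
  proof (cases "sindex z > 1")
    case True
    then have "z = x \<or> z = y" using generator_mem_of_sindex_gt_1[OF z] by auto
    then show ?thesis using s t by auto
  next
    (* For index 1, equality of powers is congruence of exponents modulo the period. *)
    case False
    then have eq: "spow z i = spow z j" if "i > 0" "j > 0" "[i = j] (mod speriod z)" for i j
      using that by (intro spow_eqI) auto
    from prime_power_residues_chain[OF r, of s t]
    show ?thesis
    proof (elim disjE exE conjE)
      fix k assume "k > 0" "[s * k = t] (mod speriod z)"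
      then have "k > 0 \<and> y = spow x k" using s t eq[of "s * k" t] by (simp add: spow_mult)
      then show ?thesis by blast
    next
      fix k assume "k > 0" "[t * k = s] (mod speriod z)"
      then have "k > 0 \<and> x = spow y k" using s t eq[of "t * k" s] by (simp add: spow_mult)
      then show ?thesis by blast
    qed
  qed
qed

theorem theorem4p6:
  shows "((cyclic_graph :: 'a::{semigroup_mult, finite} sgraph) = power_graph
            \<longleftrightarrow> (\<forall>H :: 'a set. cyclic_subgroup H \<longrightarrow> prime_power (card H)))
       \<and> ((\<forall>H :: 'a set. cyclic_subgroup H \<longrightarrow> prime_power (card H))
            \<longleftrightarrow> (\<forall>a :: 'a. \<exists>p m n. prime p \<and> m > 0 \<and> gen_is_M a m (p ^ n)))"
proof -
  have "(cyclic_graph :: 'a sgraph) = power_graph \<longleftrightarrow> (\<forall>a :: 'a. prime_power (speriod a))"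
    unfolding graphs_eq_iff
    using prime_power_period_if_comparable comparable_if_prime_power_period by blast
  moreover have "(\<forall>a :: 'a. \<exists>p m n. prime p \<and> m > 0 \<and> gen_is_M a m (p ^ n))
      \<longleftrightarrow> (\<forall>a :: 'a. prime_power (speriod a))"
    unfolding gen_is_M_def prime_power_def using sindex_pos by metis
  ultimately show ?thesis by (simp only: cyclic_subgroups_iff_periods)
qed

end
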